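(* Let $\Gamma=\mathrm{Cay}(G;S)$ be the Cayley graph of a finite group $G$ of order $N$, where the set $S\subset G$ is closed under conjugation. Equip $\mathbb{C}^N$ (identified with the functions $G\to\mathbb{C}$) with the orthonormal basis $\{\phi^\pi_{i,j}:\pi\in\widehat{G},\ 1\le i,j\le d_\pi\}$, where $\phi^\pi_{i,j}=\sqrt{d_\pi/N}\,\pi_{i,j}$, enumerated as $\phi_1,\dots,\phi_N$, and let $\Phi$ be the unitary matrix with these columns. Let $\mathfrak{g}\in\mathbb{C}^N$ and assume that $\widehat{\mathfrak{g}}$ is constant over every representation of $G$, i.e. for every $\pi\in\widehat{G}$ and $i,j=1,\dots,d_\pi$, $\widehat{\mathfrak{g}}(\phi^\pi_{i,j})=\widehat{\mathfrak{g}}_\pi$ for some constant $\widehat{\mathfrak{g}}_\pi\in\mathbb{C}$ that depends only on $\pi$ (it is independent of $i$ and $j$). Let $\{f_j\}_{j=1}^N$ be an orthonormal basis of $\mathbb{C}^N$ and define $A_i=\Phi D_{f_i}\Phi^*$ for $i=1,\dots,N$. Then the family of vectors $\{\mathfrak{g}_{m,\ell}:=\phi_\ell\circ(A_m\mathfrak{g}) : m,\ell=1,\dots,N\}$ forms a tight frame with optimal frame bounds $$A=B=\frac1N\sum_{\pi\in\widehat{G}}|\widehat{\mathfrak{g}}_\pi|^2d_\pi^2.$$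
   Context: The Cayley graph $\mathrm{Cay}(G;S)$ has vertex set $G$, with $(x,y)$ an edge if and only if $x^{-1}y\in S$; signals on it are functions $G\to\mathbb{C}$. $\widehat{G}$ denotes a fixed set of representatives of the equivalence classes of irreducible unitary representations of $G$, each $\pi\in\widehat G$ being a homomorphism $\pi:G\to U_{d_\pi}(\mathbb{C})$ into the unitary $d_\pi\times d_\pi$ matrices, with coordinate functionals $\pi_{i,j}:G\to\mathbb{C}$, $\pi_{i,j}(g)=\langle\pi(g)e_j,e_i\rangle$. By Schur orthogonality the vectors $\phi^\pi_{i,j}$ form an orthonormal basis of $\mathbb{C}^N$. The Fourier coefficients are $\widehat{\mathfrak{g}}(\phi^\pi_{i,j})=\langle\mathfrak{g},\phi^\pi_{i,j}\rangle=\sum_{x\in G}\mathfrak{g}(x)\overline{\phi^\pi_{i,j}(x)}$. $D_w$ is the diagonal matrix with diagonal $w$, and $\circ$ is the entrywise product. A finite family $\{\psi_x\}$ in $\mathbb{C}^N$ is a frame if there are $A,B>0$ with $A\|f\|_2^2\le\sum_x|\langle f,\psi_x\rangle|^2\le B\|f\|_2^2$ for all $f$; the optimal bounds are the largest such $A$ and smallest such $B$, and the frame is tight if they are equal.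
   Formalization: The formal theorem additionally assumes that 𝔤 is not the zero vector; for 𝔤 = 0 all constants are 0 and the family consists of zero vectors, which is not a frame since frame bounds must be positive. *)

theory Defs
  imports
    "HOL-Algebra.Group"
    "Graph_Theory.Pair_Digraph"
    "Jordan_Normal_Form.Schur_Decomposition"
begin

definition cayley_graph :: "('a, 'm) monoid_scheme \<Rightarrow> 'a set \<Rightarrow> 'a pair_pre_digraph" where
  "cayley_graph G S =
    \<lparr> pverts = carrier G,
      parcs = {(x, y). x \<in> carrier G \<and> y \<in> carrier G \<and> inv\<^bsub>G\<^esub> x \<otimes>\<^bsub>G\<^esub> y \<in> S} \<rparr>"

definition unitary_group :: "nat \<Rightarrow> complex mat monoid" where
  "unitary_group d =
    \<lparr> carrier = {U \<in> carrier_mat d d. mat_adjoint U * U = 1\<^sub>m d \<and> U * mat_adjoint U = 1\<^sub>m d},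
      mult = (*), one = 1\<^sub>m d \<rparr>"

text \<open>
  A representation is a plain matrix-valued function; its degree is recovered from the size of
  its value at the identity. Values outside the carrier are irrelevant throughout.
\<close>

definition rep_dim :: "('a, 'm) monoid_scheme \<Rightarrow> ('a \<Rightarrow> complex mat) \<Rightarrow> nat" where
  "rep_dim G \<pi> = dim_row (\<pi> \<one>\<^bsub>G\<^esub>)"

definition unitary_rep :: "('a, 'm) monoid_scheme \<Rightarrow> ('a \<Rightarrow> complex mat) \<Rightarrow> bool" where
  "unitary_rep G \<pi> \<longleftrightarrow> \<pi> \<in> hom G (unitary_group (rep_dim G \<pi>))"

definition irreducible_unitary_rep ::
    "('a, 'm) monoid_scheme \<Rightarrow> ('a \<Rightarrow> complex mat) \<Rightarrow> bool" where
  "irreducible_unitary_rep G \<pi> \<longleftrightarrow>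
    unitary_rep G \<pi> \<and> 0 < rep_dim G \<pi> \<and>
    (\<forall>W. subspace class_ring W (module_vec TYPE(complex) (rep_dim G \<pi>)) \<and>
         (\<forall>x\<in>carrier G. \<forall>w\<in>W. \<pi> x *\<^sub>v w \<in> W) \<longrightarrow>
         W = {0\<^sub>v (rep_dim G \<pi>)} \<or> W = carrier_vec (rep_dim G \<pi>))"

definition equivalent_reps ::
    "('a, 'm) monoid_scheme \<Rightarrow> ('a \<Rightarrow> complex mat) \<Rightarrow> ('a \<Rightarrow> complex mat) \<Rightarrow> bool" where
  "equivalent_reps G \<pi> \<sigma> \<longleftrightarrow>
    rep_dim G \<pi> = rep_dim G \<sigma> \<and>
    (\<exists>T \<in> carrier_mat (rep_dim G \<pi>) (rep_dim G \<pi>).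
       invertible_mat T \<and> (\<forall>x\<in>carrier G. T * \<pi> x = \<sigma> x * T))"

definition dual_representatives ::
    "('a, 'm) monoid_scheme \<Rightarrow> ('a \<Rightarrow> complex mat) set \<Rightarrow> bool" where
  "dual_representatives G R \<longleftrightarrow>
    (\<forall>\<pi>\<in>R. irreducible_unitary_rep G \<pi>) \<and>
    (\<forall>\<sigma>. irreducible_unitary_rep G \<sigma> \<longrightarrow> (\<exists>!\<pi>. \<pi> \<in> R \<and> equivalent_reps G \<sigma> \<pi>))"

definition coord_fun :: "('a \<Rightarrow> complex mat) \<Rightarrow> nat \<Rightarrow> nat \<Rightarrow> 'a \<Rightarrow> complex" where
  "coord_fun \<pi> i j x =
    (\<pi> x *\<^sub>v unit_vec (dim_col (\<pi> x)) j) \<bullet>c unit_vec (dim_row (\<pi> x)) i"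

lemma coord_fun_eq_entry:
  assumes "i < dim_row (\<pi> x)" "j < dim_col (\<pi> x)"
  shows "coord_fun \<pi> i j x = \<pi> x $$ (i, j)"
proof -
  have "conjugate (unit_vec n i) = (unit_vec n i :: complex vec)" for n
    by (rule eq_vecI) (auto simp: unit_vec_def)
  then show ?thesis
    using assms by (simp add: coord_fun_def mult_mat_vec_def)
qed

definition rep_indices ::
    "('a, 'm) monoid_scheme \<Rightarrow> ('a \<Rightarrow> complex mat) set \<Rightarrow> (('a \<Rightarrow> complex mat) \<times> nat \<times> nat) set" where
  "rep_indices G R = {(\<pi>, i, j). \<pi> \<in> R \<and> i < rep_dim G \<pi> \<and> j < rep_dim G \<pi>}"

definition fourier_basis ::
    "('a, 'm) monoid_scheme \<Rightarrow> ('a \<Rightarrow> complex mat) \<times> nat \<times> nat \<Rightarrow> 'a \<Rightarrow> complex" where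
  "fourier_basis G = (\<lambda>(\<pi>, i, j) x.
    complex_of_real (sqrt (real (rep_dim G \<pi>) / real (card (carrier G)))) * coord_fun \<pi> i j x)"

definition fourier_coeff ::
    "('a, 'm) monoid_scheme \<Rightarrow> ('a \<Rightarrow> complex) \<Rightarrow> ('a \<Rightarrow> complex) \<Rightarrow> complex" where
  "fourier_coeff G g \<phi> = (\<Sum>x\<in>carrier G. g x * cnj (\<phi> x))"

text \<open>Identification of functions on the vertices with \<open>\<complex>\<^sup>n\<close> via an enumeration \<open>v\<close> of the vertices.\<close>

definition signal_vec :: "nat \<Rightarrow> (nat \<Rightarrow> 'a) \<Rightarrow> ('a \<Rightarrow> complex) \<Rightarrow> complex vec" where
  "signal_vec n v h = vec n (\<lambda>k. h (v k))"

definition hadamard_vec :: "complex vec \<Rightarrow> complex vec \<Rightarrow> complex vec" where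
  "hadamard_vec u w = vec (dim_vec u) (\<lambda>k. u $ k * w $ k)"

definition l2_norm :: "complex vec \<Rightarrow> real" where
  "l2_norm u = sqrt (\<Sum>k<dim_vec u. (cmod (u $ k))\<^sup>2)"

definition orthonormal_basis :: "nat \<Rightarrow> (nat \<Rightarrow> complex vec) \<Rightarrow> bool" where
  "orthonormal_basis n b \<longleftrightarrow>
    (\<forall>i<n. b i \<in> carrier_vec n) \<and>
    (\<forall>i<n. \<forall>j<n. b i \<bullet>c b j = (if i = j then 1 else 0)) \<and>
    vectorspace.basis class_ring (module_vec TYPE(complex) n) (b ` {..<n})"

definition frame_bounds ::
    "nat \<Rightarrow> 'i set \<Rightarrow> ('i \<Rightarrow> complex vec) \<Rightarrow> real \<Rightarrow> real \<Rightarrow> bool" where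
  "frame_bounds n I \<psi> A B \<longleftrightarrow>
    0 < A \<and> 0 < B \<and>
    (\<forall>f \<in> carrier_vec n.
      A * (l2_norm f)\<^sup>2 \<le> (\<Sum>i\<in>I. (cmod (f \<bullet>c \<psi> i))\<^sup>2) \<and>
      (\<Sum>i\<in>I. (cmod (f \<bullet>c \<psi> i))\<^sup>2) \<le> B * (l2_norm f)\<^sup>2)"

definition is_frame :: "nat \<Rightarrow> 'i set \<Rightarrow> ('i \<Rightarrow> complex vec) \<Rightarrow> bool" where
  "is_frame n I \<psi> \<longleftrightarrow>
    finite I \<and> (\<forall>i\<in>I. \<psi> i \<in> carrier_vec n) \<and> (\<exists>A B. frame_bounds n I \<psi> A B)"

definition optimal_frame_bounds ::
    "nat \<Rightarrow> 'i set \<Rightarrow> ('i \<Rightarrow> complex vec) \<Rightarrow> real \<Rightarrow> real \<Rightarrow> bool" where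
  "optimal_frame_bounds n I \<psi> A B \<longleftrightarrow>
    frame_bounds n I \<psi> A B \<and>
    (\<forall>A' B'. frame_bounds n I \<psi> A' B' \<longrightarrow> A' \<le> A \<and> B \<le> B')"

definition tight_frame :: "nat \<Rightarrow> 'i set \<Rightarrow> ('i \<Rightarrow> complex vec) \<Rightarrow> bool" where
  "tight_frame n I \<psi> \<longleftrightarrow>
    is_frame n I \<psi> \<and> (\<exists>A B. optimal_frame_bounds n I \<psi> A B \<and> A = B)"

end

(*
  By Schur orthogonality the functions phi_k are orthonormal. Expanding A_m g in this basis,
  Parseval for the f_m and then for the phi_l turns the sum of |<h, psi_{m,l}>|^2 into
  sum_x |h(x)|^2 * sum_k |ghat(k)|^2 |phi_k(x)|^2. Since ghat is constant over each pi and the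
  squared entries of the unitary matrix pi(x) sum up to d_pi, the inner sum does not depend
  on x; it equals the claimed frame bound. It is positive because g is nonzero.
*)

theory Submission
  imports Defs "Jordan_Normal_Form.Spectral_Radius"
begin

text \<open>Representation theory has to deliver orthonormality only, not completeness:
  \<open>e\<close> numbers the indices by exactly N numbers, so the orthonormal functions fill a
  square matrix, whose one-sided inverse is two-sided. This is what makes Parseval available for
  them. Schur orthogonality itself is obtained by averaging an elementary matrix over the group. The
  average is an intertwiner; it vanishes between inequivalent irreducibles and is scalar on a single
  one. The factor d_\<pi>^2 / N in the bound has two sources: d_\<pi> / N is the square of the
  normalisation of the matrix coefficients, and the other d_\<pi> is the squared Frobenius norm of a
  unitary matrix. A single |\<pi>_{i,j}(x)|^2 may vary with x; constancy of the coefficients on each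
  block is what lets all entries of \<pi>(x) enter with the same weight.\<close>

lemma subspace_module_vecI:
  assumes "W \<subseteq> carrier_vec n" "0\<^sub>v n \<in> W"
    and "\<And>u w. u \<in> W \<Longrightarrow> w \<in> W \<Longrightarrow> u + w \<in> W"
    and "\<And>a w. w \<in> W \<Longrightarrow> a \<cdot>\<^sub>v w \<in> W"
  shows "subspace class_ring W (module_vec TYPE('b :: field) n)"
proof -
  interpret vec_space "TYPE('b)" n .
  show ?thesis
    by (unfold_locales) (use assms in \<open>auto simp: module_vec_simps\<close>)
qed

lemma mat_adjoint_carrier:
  "A \<in> carrier_mat n m \<Longrightarrow> mat_adjoint A \<in> carrier_mat m n"
  unfolding mat_adjoint_def by (auto simp: mat_of_rows_def)

lemma mat_adjoint_index:
  assumes "A \<in> carrier_mat n m" "i < m" "j < n"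
  shows "mat_adjoint A $$ (i, j) = conjugate (A $$ (j, i))"
  using assms unfolding mat_adjoint_def by (simp add: mat_of_rows_def)

lemma mult_mat_vec_unit_vec:
  fixes A :: "'b :: comm_ring_1 mat"
  assumes "A \<in> carrier_mat n m" "j < m"
  shows "A *\<^sub>v unit_vec m j = col A j"
  using assms by (intro eq_vecI) auto

section \<open>Unitary representations\<close>

context group
begin

lemma unitary_rep_carrier:
  assumes "unitary_rep G \<pi>" "x \<in> carrier G"
  shows "\<pi> x \<in> carrier_mat (rep_dim G \<pi>) (rep_dim G \<pi>)"
  using assms unfolding unitary_rep_def hom_def unitary_group_def by auto

lemma unitary_rep_mult:
  assumes "unitary_rep G \<pi>" "x \<in> carrier G" "y \<in> carrier G"
  shows "\<pi> (x \<otimes> y) = \<pi> x * \<pi> y"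
  using assms unfolding unitary_rep_def hom_def unitary_group_def by auto

lemma unitary_rep_adjoint:
  assumes "unitary_rep G \<pi>" "x \<in> carrier G"
  shows "mat_adjoint (\<pi> x) * \<pi> x = 1\<^sub>m (rep_dim G \<pi>)"
    "\<pi> x * mat_adjoint (\<pi> x) = 1\<^sub>m (rep_dim G \<pi>)"
  using assms unfolding unitary_rep_def hom_def unitary_group_def by auto

text \<open>Membership in \<open>hom\<close> gives only multiplicativity, so the value at the
  identity has to be derived: it is idempotent, and cancelling with its adjoint leaves the identity
  matrix.\<close>

lemma unitary_rep_one:
  assumes "unitary_rep G \<pi>"
  shows "\<pi> \<one> = 1\<^sub>m (rep_dim G \<pi>)"
proof -
  let ?d = "rep_dim G \<pi>"
  note car = unitary_rep_carrier[OF assms one_closed]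
  note adj = mat_adjoint_carrier[OF car]
  have "\<pi> \<one> = (mat_adjoint (\<pi> \<one>) * \<pi> \<one>) * \<pi> \<one>"
    using unitary_rep_adjoint(1)[OF assms one_closed] car by simp
  also have "\<dots> = mat_adjoint (\<pi> \<one>) * (\<pi> \<one> * \<pi> \<one>)"
    using car adj by (intro assoc_mult_mat)
  also have "\<pi> \<one> * \<pi> \<one> = \<pi> \<one>"
    using unitary_rep_mult[OF assms one_closed one_closed] by simp
  finally show ?thesis
    using unitary_rep_adjoint(1)[OF assms one_closed] by simp
qed

lemma unitary_rep_inv:
  assumes "unitary_rep G \<pi>" "x \<in> carrier G"
  shows "\<pi> (inv x) = mat_adjoint (\<pi> x)"
proof -
  have x': "inv x \<in> carrier G" using assms by simp
  note car = unitary_rep_carrier[OF assms] unitary_rep_carrier[OF assms(1) x']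
  note adj = mat_adjoint_carrier[OF car(1)]
  have "\<pi> (inv x) = \<pi> (inv x) * (\<pi> x * mat_adjoint (\<pi> x))"
    using unitary_rep_adjoint(2)[OF assms] car by simp
  also have "\<dots> = (\<pi> (inv x) * \<pi> x) * mat_adjoint (\<pi> x)"
    using car adj by (intro assoc_mult_mat[symmetric])
  also have "\<pi> (inv x) * \<pi> x = 1\<^sub>m (rep_dim G \<pi>)"
    using unitary_rep_mult[OF assms(1) x' assms(2)] unitary_rep_one[OF assms(1)] assms by simp
  finally show ?thesis using adj by simp
qed

text \<open>Each row of a unitary matrix is a unit vector, as the diagonal of \<pi>(x) times its
  adjoint shows. The squared Frobenius norm is therefore the same at every x.\<close>

lemma unitary_rep_entries_norm:
  assumes "unitary_rep G \<pi>" "x \<in> carrier G"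
  shows "(\<Sum>i<rep_dim G \<pi>. \<Sum>j<rep_dim G \<pi>. (cmod (\<pi> x $$ (i, j)))\<^sup>2) = real (rep_dim G \<pi>)"
proof -
  let ?d = "rep_dim G \<pi>"
  note car = unitary_rep_carrier[OF assms]
  note adj = mat_adjoint_carrier[OF car]
  have "(\<Sum>j<?d. (cmod (\<pi> x $$ (i, j)))\<^sup>2) = 1" if "i < ?d" for i
  proof -
    have "complex_of_real (\<Sum>j<?d. (cmod (\<pi> x $$ (i, j)))\<^sup>2)
        = (\<Sum>j<?d. \<pi> x $$ (i, j) * cnj (\<pi> x $$ (i, j)))"
      by (simp flip: complex_norm_square)
    also have "\<dots> = (\<pi> x * mat_adjoint (\<pi> x)) $$ (i, i)"
      using car adj that
      by (simp add: scalar_prod_def mat_adjoint_index[OF car] atLeast0LessThan)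
    finally show ?thesis
      using unitary_rep_adjoint(2)[OF assms] that by (metis index_one_mat(1) of_real_eq_1_iff)
  qed
  then show ?thesis by simp
qed

section \<open>Schur's lemma and Schur orthogonality\<close>

text \<open>The kernel of an intertwiner is invariant under the source representation
  \<open>\<pi>\<close>, so irreducibility leaves only the zero space and the whole space.\<close>

lemma intertwiner_zero_or_injective:
  assumes \<pi>: "irreducible_unitary_rep G \<pi>" and \<sigma>: "unitary_rep G \<sigma>"
    and T: "T \<in> carrier_mat (rep_dim G \<sigma>) (rep_dim G \<pi>)"
    and comm: "\<And>x. x \<in> carrier G \<Longrightarrow> T * \<pi> x = \<sigma> x * T"
  shows "T = 0\<^sub>m (rep_dim G \<sigma>) (rep_dim G \<pi>) \<or>
    (\<forall>w\<in>carrier_vec (rep_dim G \<pi>). T *\<^sub>v w = 0\<^sub>v (rep_dim G \<sigma>) \<longrightarrow> w = 0\<^sub>v (rep_dim G \<pi>))"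
proof -
  let ?d = "rep_dim G \<pi>" and ?e = "rep_dim G \<sigma>"
  define W where "W = {w \<in> carrier_vec ?d. T *\<^sub>v w = 0\<^sub>v ?e}"
  have u: "unitary_rep G \<pi>" using \<pi> by (simp add: irreducible_unitary_rep_def)
  have "subspace class_ring W (module_vec TYPE(complex) ?d)"
    using T by (intro subspace_module_vecI)
      (auto simp: W_def mult_add_distrib_mat_vec[OF T] mult_mat_vec[OF T])
  moreover have "\<pi> x *\<^sub>v w \<in> W" if x: "x \<in> carrier G" and w: "w \<in> W" for x w
  proof -
    have w': "w \<in> carrier_vec ?d" "T *\<^sub>v w = 0\<^sub>v ?e" using w by (auto simp: W_def)
    note cx = unitary_rep_carrier[OF u x] unitary_rep_carrier[OF \<sigma> x]
    have "T *\<^sub>v (\<pi> x *\<^sub>v w) = (T * \<pi> x) *\<^sub>v w"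
      using T cx w' by (intro assoc_mult_mat_vec[symmetric])
    also have "\<dots> = \<sigma> x *\<^sub>v (T *\<^sub>v w)"
      unfolding comm[OF x] using T cx w' by (intro assoc_mult_mat_vec)
    also have "\<dots> = 0\<^sub>v ?e" using w' cx by (auto intro!: eq_vecI)
    finally show ?thesis using cx w' by (simp add: W_def)
  qed
  ultimately consider "W = {0\<^sub>v ?d}" | "W = carrier_vec ?d"
    using \<pi> unfolding irreducible_unitary_rep_def by blast
  then show ?thesis
  proof cases
    case 1
    then show ?thesis by (auto simp: W_def)
  next
    case 2
    have "T = 0\<^sub>m ?e ?d"
    proof (rule eq_matI)
      fix i j assume ij: "i < dim_row (0\<^sub>m ?e ?d :: complex mat)" "j < dim_col (0\<^sub>m ?e ?d :: complex mat)"
      then have "unit_vec ?d j \<in> W" using 2 by simp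
      then have "col T j = 0\<^sub>v ?e" using ij T by (simp add: W_def mult_mat_vec_unit_vec)
      then have "col T j $ i = 0" using ij by simp
      then show "T $$ (i, j) = 0\<^sub>m ?e ?d $$ (i, j)" using ij T by simp
    qed (use T in auto)
    then show ?thesis ..
  qed
qed

text \<open>Dual argument: the image of an intertwiner is invariant under the target representation
  \<open>\<sigma>\<close>, whose irreducibility decides between zero and everything.\<close>

lemma intertwiner_zero_or_surjective:
  assumes \<sigma>: "irreducible_unitary_rep G \<sigma>" and \<pi>: "unitary_rep G \<pi>"
    and T: "T \<in> carrier_mat (rep_dim G \<sigma>) (rep_dim G \<pi>)"
    and comm: "\<And>x. x \<in> carrier G \<Longrightarrow> T * \<pi> x = \<sigma> x * T"
  shows "T = 0\<^sub>m (rep_dim G \<sigma>) (rep_dim G \<pi>) \<or>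
    (\<forall>w\<in>carrier_vec (rep_dim G \<sigma>). \<exists>u\<in>carrier_vec (rep_dim G \<pi>). T *\<^sub>v u = w)"
proof -
  let ?d = "rep_dim G \<pi>" and ?e = "rep_dim G \<sigma>"
  define W where "W = (\<lambda>u. T *\<^sub>v u) ` carrier_vec ?d"
  have u: "unitary_rep G \<sigma>" using \<sigma> by (simp add: irreducible_unitary_rep_def)
  have "subspace class_ring W (module_vec TYPE(complex) ?e)"
  proof (rule subspace_module_vecI)
    show "W \<subseteq> carrier_vec ?e" using T by (auto simp: W_def)
    have "T *\<^sub>v 0\<^sub>v ?d = 0\<^sub>v ?e" using T by (auto intro!: eq_vecI)
    then show "0\<^sub>v ?e \<in> W" unfolding W_def by (metis image_eqI zero_carrier_vec)
    fix w w' assume "w \<in> W" "w' \<in> W"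
    then show "w + w' \<in> W"
      by (auto simp: W_def mult_add_distrib_mat_vec[OF T, symmetric])
  next
    fix a w assume "w \<in> W"
    then show "a \<cdot>\<^sub>v w \<in> W"
      by (auto simp: W_def mult_mat_vec[OF T, symmetric])
  qed
  moreover have "\<sigma> x *\<^sub>v w \<in> W" if x: "x \<in> carrier G" and w: "w \<in> W" for x w
  proof -
    obtain v where v: "v \<in> carrier_vec ?d" "w = T *\<^sub>v v" using w by (auto simp: W_def)
    note cx = unitary_rep_carrier[OF \<pi> x] unitary_rep_carrier[OF u x]
    have "\<sigma> x *\<^sub>v w = (\<sigma> x * T) *\<^sub>v v"
      unfolding v using T cx v by (intro assoc_mult_mat_vec[symmetric])
    also have "\<dots> = T *\<^sub>v (\<pi> x *\<^sub>v v)"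
      unfolding comm[OF x, symmetric] using T cx v by (intro assoc_mult_mat_vec)
    finally show ?thesis using cx v by (auto simp: W_def)
  qed
  ultimately consider "W = {0\<^sub>v ?e}" | "W = carrier_vec ?e"
    using \<sigma> unfolding irreducible_unitary_rep_def by blast
  then show ?thesis
  proof cases
    case 1
    have "T = 0\<^sub>m ?e ?d"
    proof (rule eq_matI)
      fix i j assume ij: "i < dim_row (0\<^sub>m ?e ?d :: complex mat)" "j < dim_col (0\<^sub>m ?e ?d :: complex mat)"
      then have "T *\<^sub>v unit_vec ?d j \<in> W" by (auto simp: W_def)
      then have "col T j = 0\<^sub>v ?e" using ij T 1 by (simp add: mult_mat_vec_unit_vec)
      then have "col T j $ i = 0" using ij by simp
      then show "T $$ (i, j) = 0\<^sub>m ?e ?d $$ (i, j)" using ij T by simp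
    qed (use T in auto)
    then show ?thesis ..
  next
    case 2
    then have "w \<in> W" if "w \<in> carrier_vec ?e" for w using that by simp
    then show ?thesis unfolding W_def by (metis imageE)
  qed
qed

text \<open>
  A right inverse of a bijective \<open>T\<close> is also a left inverse, and comparing the traces of
  \<open>T S\<close> and \<open>S T\<close> gives equality of the degrees without rank-nullity.
\<close>

lemma intertwiner_zero_or_equivalent:
  assumes \<pi>: "irreducible_unitary_rep G \<pi>" and \<sigma>: "irreducible_unitary_rep G \<sigma>"
    and T: "T \<in> carrier_mat (rep_dim G \<sigma>) (rep_dim G \<pi>)"
    and comm: "\<And>x. x \<in> carrier G \<Longrightarrow> T * \<pi> x = \<sigma> x * T"
  shows "T = 0\<^sub>m (rep_dim G \<sigma>) (rep_dim G \<pi>) \<or> equivalent_reps G \<pi> \<sigma>"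
proof -
  let ?d = "rep_dim G \<pi>" and ?e = "rep_dim G \<sigma>"
  have "equivalent_reps G \<pi> \<sigma>" if nz: "T \<noteq> 0\<^sub>m ?e ?d"
  proof -
    have u: "unitary_rep G \<pi>" "unitary_rep G \<sigma>"
      using \<pi> \<sigma> by (simp_all add: irreducible_unitary_rep_def)
    have inj: "w = 0\<^sub>v ?d" if "w \<in> carrier_vec ?d" "T *\<^sub>v w = 0\<^sub>v ?e" for w
      using intertwiner_zero_or_injective[OF \<pi> u(2) T comm] nz that by blast
    have "\<forall>w\<in>carrier_vec ?e. \<exists>u\<in>carrier_vec ?d. T *\<^sub>v u = w"
      using intertwiner_zero_or_surjective[OF \<sigma> u(1) T comm] nz by blast
    then obtain r where r: "\<And>w. w \<in> carrier_vec ?e \<Longrightarrow> r w \<in> carrier_vec ?d \<and> T *\<^sub>v r w = w"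
      by metis
    \<comment> \<open>Column j is a chosen preimage under \<open>T\<close> of the j-th unit
      vector.\<close>
    define S where "S = mat_of_cols ?d (map (\<lambda>j. r (unit_vec ?e j)) [0..<?e])"
    have S: "S \<in> carrier_mat ?d ?e" by (simp add: S_def mat_of_cols_def)
    have colS: "col S j = r (unit_vec ?e j)" if "j < ?e" for j
      using that r[of "unit_vec ?e j"] by (simp add: S_def)
    have TS: "T * S = 1\<^sub>m ?e"
    proof (rule mat_col_eqI)
      fix j assume j: "j < dim_col (1\<^sub>m ?e :: complex mat)"
      then have "col (T * S) j = T *\<^sub>v col S j" using S T by (intro col_mult2) auto
      then show "col (T * S) j = col (1\<^sub>m ?e) j" using j r colS by simp
    qed (use T S in auto)
    have ST: "S * T = 1\<^sub>m ?d"
    proof (rule mat_col_eqI)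
      fix j assume j': "j < dim_col (1\<^sub>m ?d :: complex mat)"
      then have j: "j < ?d" by simp
      let ?w = "S *\<^sub>v col T j"
      have c: "col T j \<in> carrier_vec ?e" using T j by auto
      then have w: "?w \<in> carrier_vec ?d" using S by auto
      \<comment> \<open>\<open>T\<close> sends S T e_j and e_j to the same vector, so injectivity
        identifies them; this is the j-th column of S T = 1.\<close>
      have "T *\<^sub>v ?w = (T * S) *\<^sub>v col T j"
        using T S c by (intro assoc_mult_mat_vec[symmetric])
      also have "\<dots> = T *\<^sub>v unit_vec ?d j"
        using TS c j T by (simp add: mult_mat_vec_unit_vec)
      finally have "T *\<^sub>v (?w - unit_vec ?d j) = 0\<^sub>v ?e"
        using T w j by (simp add: mult_minus_distrib_mat_vec[OF T])
      then have "?w - unit_vec ?d j = 0\<^sub>v ?d" using w by (intro inj) auto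
      then have "?w = unit_vec ?d j"
        using w S by (intro eq_vecI) (auto simp: vec_eq_iff)
      then show "col (S * T) j = col (1\<^sub>m ?d) j"
        using j by (simp only: col_mult2[OF S T j] col_one)
    qed (use T S in auto)
    have "complex_of_nat ?e = (\<Sum>i<?e. (T * S) $$ (i, i))" by (simp add: TS)
    also have "\<dots> = (\<Sum>i<?e. \<Sum>j<?d. T $$ (i, j) * S $$ (j, i))"
      using T S by (simp add: scalar_prod_def atLeast0LessThan)
    also have "\<dots> = (\<Sum>j<?d. \<Sum>i<?e. S $$ (j, i) * T $$ (i, j))"
      by (subst sum.swap) (simp add: mult.commute)
    also have "\<dots> = (\<Sum>j<?d. (S * T) $$ (j, j))"
      using T S by (simp add: scalar_prod_def atLeast0LessThan)
    also have "\<dots> = complex_of_nat ?d" by (simp add: ST)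
    finally have de: "?e = ?d" by simp
    moreover have "invertible_mat T"
      unfolding invertible_mat_def inverts_mat_def using T S TS ST de
      by (auto intro!: exI[of _ S])
    ultimately show "equivalent_reps G \<pi> \<sigma>"
      unfolding equivalent_reps_def using T comm by auto
  qed
  then show ?thesis by blast
qed

text \<open>Over the complex numbers \<open>T\<close> has an eigenvalue \<open>a\<close>. Then
  \<open>T\<close> minus \<open>a\<close> times the identity is again an intertwiner, and an
  eigenvector in its kernel rules out injectivity, so it is zero.\<close>

lemma self_intertwiner_scalar:
  assumes \<pi>: "irreducible_unitary_rep G \<pi>"
    and T: "T \<in> carrier_mat (rep_dim G \<pi>) (rep_dim G \<pi>)"
    and comm: "\<And>x. x \<in> carrier G \<Longrightarrow> T * \<pi> x = \<pi> x * T"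
  obtains a where "T = a \<cdot>\<^sub>m 1\<^sub>m (rep_dim G \<pi>)"
proof -
  let ?d = "rep_dim G \<pi>"
  have u: "unitary_rep G \<pi>" and d: "?d > 0"
    using \<pi> by (simp_all add: irreducible_unitary_rep_def)
  obtain a where "eigenvalue T a"
    using spectrum_non_empty[OF T d] by (auto simp: spectrum_def)
  then obtain w where w: "w \<in> carrier_vec ?d" "w \<noteq> 0\<^sub>v ?d" "T *\<^sub>v w = a \<cdot>\<^sub>v w"
    using T by (auto simp: eigenvalue_def eigenvector_def)
  define D where "D = T - a \<cdot>\<^sub>m 1\<^sub>m ?d"
  have D: "D \<in> carrier_mat ?d ?d" using T by (auto simp: D_def)
  have "D * \<pi> x = \<pi> x * D" if x: "x \<in> carrier G" for x
  proof -
    note cx = unitary_rep_carrier[OF u x]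
    have "D * \<pi> x = T * \<pi> x - a \<cdot>\<^sub>m 1\<^sub>m ?d * \<pi> x"
      unfolding D_def using T cx by (intro minus_mult_distrib_mat) auto
    also have "a \<cdot>\<^sub>m 1\<^sub>m ?d * \<pi> x = \<pi> x * (a \<cdot>\<^sub>m 1\<^sub>m ?d)"
      using cx by (simp add: mult_smult_assoc_mat[of _ ?d ?d] mult_smult_distrib[OF cx one_carrier_mat])
    also have "T * \<pi> x - \<pi> x * (a \<cdot>\<^sub>m 1\<^sub>m ?d) = \<pi> x * D"
      unfolding D_def comm[OF x] using T cx by (intro mult_minus_distrib_mat[symmetric]) auto
    finally show ?thesis .
  qed
  moreover have "D *\<^sub>v w = 0\<^sub>v ?d"
  proof -
    have "D *\<^sub>v w = T *\<^sub>v w - (a \<cdot>\<^sub>m 1\<^sub>m ?d) *\<^sub>v w"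
      unfolding D_def using T w by (intro minus_mult_distrib_mat_vec) auto
    also have "(a \<cdot>\<^sub>m 1\<^sub>m ?d) *\<^sub>v w = a \<cdot>\<^sub>v w"
      using w by (intro eq_vecI) (auto simp: smult_scalar_prod_distrib[of _ ?d])
    finally show ?thesis using w by simp
  qed
  ultimately have "D = 0\<^sub>m ?d ?d"
    using intertwiner_zero_or_injective[OF \<pi> u D] w by blast
  then have "T = a \<cdot>\<^sub>m 1\<^sub>m ?d"
    using T by (auto simp: D_def mat_eq_iff)
  then show ?thesis by (rule that)
qed

text \<open>This is the sum over x of \<sigma>(x) E \<pi>(x)^*, with E the elementary matrix that
  has its 1 at (i, j). Its entries are exactly the sums that Schur orthogonality evaluates.\<close>

definition rep_average :: "('a \<Rightarrow> complex mat) \<Rightarrow> ('a \<Rightarrow> complex mat) \<Rightarrow> nat \<Rightarrow> nat \<Rightarrow> complex mat" where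
  "rep_average \<sigma> \<pi> i j = mat (rep_dim G \<sigma>) (rep_dim G \<pi>)
     (\<lambda>(a, b). \<Sum>x\<in>carrier G. \<sigma> x $$ (a, i) * cnj (\<pi> x $$ (b, j)))"

text \<open>A factor \<pi>(y) on the right turns \<pi>(x)^* into the adjoint of \<pi>(y^{-1} x);
  translating the summation variable by y moves the shift into \<sigma>, where it comes out as
  \<sigma>(y) on the left.\<close>

lemma rep_average_intertwines:
  assumes \<pi>: "unitary_rep G \<pi>" and \<sigma>: "unitary_rep G \<sigma>"
    and i: "i < rep_dim G \<sigma>" and j: "j < rep_dim G \<pi>" and y: "y \<in> carrier G"
  shows "rep_average \<sigma> \<pi> i j * \<pi> y = \<sigma> y * rep_average \<sigma> \<pi> i j"
proof (rule eq_matI)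
  let ?d = "rep_dim G \<pi>" and ?e = "rep_dim G \<sigma>"
  have y': "inv y \<in> carrier G" using y by simp
  note cy = unitary_rep_carrier[OF \<pi> y] unitary_rep_carrier[OF \<sigma> y]
  show "dim_row (rep_average \<sigma> \<pi> i j * \<pi> y) = dim_row (\<sigma> y * rep_average \<sigma> \<pi> i j)"
    "dim_col (rep_average \<sigma> \<pi> i j * \<pi> y) = dim_col (\<sigma> y * rep_average \<sigma> \<pi> i j)"
    using cy by (auto simp: rep_average_def)
  fix a b
  assume "a < dim_row (\<sigma> y * rep_average \<sigma> \<pi> i j)" "b < dim_col (\<sigma> y * rep_average \<sigma> \<pi> i j)"
  then have ab: "a < ?e" "b < ?d" using cy by (auto simp: rep_average_def)
  have "(rep_average \<sigma> \<pi> i j * \<pi> y) $$ (a, b)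
      = (\<Sum>c<?d. (\<Sum>x\<in>carrier G. \<sigma> x $$ (a, i) * cnj (\<pi> x $$ (c, j))) * \<pi> y $$ (c, b))"
    using cy ab by (simp add: rep_average_def scalar_prod_def atLeast0LessThan)
  also have "\<dots> = (\<Sum>x\<in>carrier G. \<sigma> x $$ (a, i) * (\<Sum>c<?d. \<pi> y $$ (c, b) * cnj (\<pi> x $$ (c, j))))"
    unfolding sum_distrib_left sum_distrib_right
    by (subst sum.swap) (simp add: mult_ac)
  also have "\<dots> = (\<Sum>x\<in>carrier G. \<sigma> x $$ (a, i) * cnj (\<pi> (inv y \<otimes> x) $$ (b, j)))"
  proof (rule sum.cong[OF refl])
    fix x assume x: "x \<in> carrier G"
    note cx = unitary_rep_carrier[OF \<pi> x] mat_adjoint_carrier[OF cy(1)]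
    have "cnj (\<pi> (inv y \<otimes> x) $$ (b, j)) = (\<Sum>c<?d. \<pi> y $$ (c, b) * cnj (\<pi> x $$ (c, j)))"
      unfolding unitary_rep_mult[OF \<pi> y' x] unitary_rep_inv[OF \<pi> y]
      using cx ab j
      by (simp add: scalar_prod_def atLeast0LessThan mat_adjoint_index[OF cy(1)])
    then show "\<sigma> x $$ (a, i) * (\<Sum>c<?d. \<pi> y $$ (c, b) * cnj (\<pi> x $$ (c, j)))
        = \<sigma> x $$ (a, i) * cnj (\<pi> (inv y \<otimes> x) $$ (b, j))" by simp
  qed
  \<comment> \<open>Left translation by \<open>y\<close> permutes the group, which is the whole
    effect of averaging.\<close>
  also have "\<dots> = (\<Sum>x\<in>carrier G. \<sigma> (y \<otimes> x) $$ (a, i) * cnj (\<pi> x $$ (b, j)))"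
    by (rule sum.reindex_bij_witness[where i = "\<lambda>x. y \<otimes> x" and j = "\<lambda>x. inv y \<otimes> x"])
      (use y in \<open>auto simp: m_assoc[symmetric]\<close>)
  also have "\<dots> = (\<Sum>x\<in>carrier G. (\<Sum>c<?e. \<sigma> y $$ (a, c) * \<sigma> x $$ (c, i)) * cnj (\<pi> x $$ (b, j)))"
  proof (rule sum.cong[OF refl])
    fix x assume x: "x \<in> carrier G"
    show "\<sigma> (y \<otimes> x) $$ (a, i) * cnj (\<pi> x $$ (b, j))
        = (\<Sum>c<?e. \<sigma> y $$ (a, c) * \<sigma> x $$ (c, i)) * cnj (\<pi> x $$ (b, j))"
      unfolding unitary_rep_mult[OF \<sigma> y x]
      using unitary_rep_carrier[OF \<sigma> x] cy ab i
      by (simp add: scalar_prod_def atLeast0LessThan)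
  qed
  also have "\<dots> = (\<Sum>c<?e. \<sigma> y $$ (a, c) * (\<Sum>x\<in>carrier G. \<sigma> x $$ (c, i) * cnj (\<pi> x $$ (b, j))))"
    unfolding sum_distrib_left sum_distrib_right
    by (subst sum.swap) (simp add: mult_ac)
  also have "\<dots> = (\<sigma> y * rep_average \<sigma> \<pi> i j) $$ (a, b)"
    using cy ab by (simp add: rep_average_def scalar_prod_def atLeast0LessThan)
  finally show "(rep_average \<sigma> \<pi> i j * \<pi> y) $$ (a, b) = (\<sigma> y * rep_average \<sigma> \<pi> i j) $$ (a, b)" .
qed

lemma schur_orthogonality_inequivalent:
  assumes \<pi>: "irreducible_unitary_rep G \<pi>" and \<sigma>: "irreducible_unitary_rep G \<sigma>"
    and "\<not> equivalent_reps G \<pi> \<sigma>"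
    and i: "a < rep_dim G \<sigma>" "i < rep_dim G \<sigma>" "b < rep_dim G \<pi>" "j < rep_dim G \<pi>"
  shows "(\<Sum>x\<in>carrier G. \<sigma> x $$ (a, i) * cnj (\<pi> x $$ (b, j))) = 0"
proof -
  have u: "unitary_rep G \<pi>" "unitary_rep G \<sigma>"
    using \<pi> \<sigma> by (simp_all add: irreducible_unitary_rep_def)
  have "rep_average \<sigma> \<pi> i j = 0\<^sub>m (rep_dim G \<sigma>) (rep_dim G \<pi>)"
    using intertwiner_zero_or_equivalent[OF \<pi> \<sigma> _ rep_average_intertwines[OF u i(2,4)]] assms(3)
    by (auto simp: rep_average_def)
  then have "rep_average \<sigma> \<pi> i j $$ (a, b) = 0" using i by simp
  then show ?thesis using i by (simp add: rep_average_def)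
qed

text \<open>The average is a scalar matrix, and its trace determines the scalar. Multiplying by the
  degree keeps the formula free of division.\<close>

lemma schur_orthogonality_self:
  assumes \<pi>: "irreducible_unitary_rep G \<pi>"
    and i: "a < rep_dim G \<pi>" "i < rep_dim G \<pi>" "b < rep_dim G \<pi>" "j < rep_dim G \<pi>"
  shows "of_nat (rep_dim G \<pi>) * (\<Sum>x\<in>carrier G. \<pi> x $$ (a, i) * cnj (\<pi> x $$ (b, j))) =
    (if a = b \<and> i = j then of_nat (card (carrier G)) else 0)"
proof -
  let ?d = "rep_dim G \<pi>"
  have u: "unitary_rep G \<pi>" using \<pi> by (simp add: irreducible_unitary_rep_def)
  obtain t where t: "rep_average \<pi> \<pi> i j = t \<cdot>\<^sub>m 1\<^sub>m ?d"
    by (rule self_intertwiner_scalar[OF \<pi> _ rep_average_intertwines[OF u u i(2,4)]])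
      (auto simp: rep_average_def)
  have entry: "(\<Sum>x\<in>carrier G. \<pi> x $$ (k, i) * cnj (\<pi> x $$ (l, j))) = (if k = l then t else 0)"
    if "k < ?d" "l < ?d" for k l
    using arg_cong[OF t, of "\<lambda>M. M $$ (k, l)"] that by (simp add: rep_average_def split: if_splits)
  \<comment> \<open>Both sides are the trace of the average. After the sums are exchanged, each x
    contributes entry (j, i) of \<pi>(x)^* \<pi>(x) = 1.\<close>
  have "of_nat ?d * t = (\<Sum>k<?d. \<Sum>x\<in>carrier G. \<pi> x $$ (k, i) * cnj (\<pi> x $$ (k, j)))"
    by (simp add: entry)
  also have "\<dots> = (\<Sum>x\<in>carrier G. \<Sum>k<?d. \<pi> x $$ (k, i) * cnj (\<pi> x $$ (k, j)))"
    by (rule sum.swap)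
  also have "\<dots> = (\<Sum>x\<in>carrier G. if i = j then 1 else 0)"
  proof (rule sum.cong[OF refl])
    fix x assume x: "x \<in> carrier G"
    note cx = unitary_rep_carrier[OF u x] mat_adjoint_carrier[OF unitary_rep_carrier[OF u x]]
    have "(\<Sum>k<?d. \<pi> x $$ (k, i) * cnj (\<pi> x $$ (k, j))) = (mat_adjoint (\<pi> x) * \<pi> x) $$ (j, i)"
      using cx i
      by (simp add: scalar_prod_def atLeast0LessThan mat_adjoint_index[OF cx(1)] mult.commute)
    then show "(\<Sum>k<?d. \<pi> x $$ (k, i) * cnj (\<pi> x $$ (k, j))) = (if i = j then 1 else 0)"
      using i unitary_rep_adjoint(1)[OF u x] by auto
  qed
  finally have "of_nat ?d * t = (if i = j then of_nat (card (carrier G)) else 0)" by simp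
  then show ?thesis using entry[OF i(1,3)] by auto
qed

section \<open>Normalised matrix coefficients as an orthonormal system\<close>

lemma sum_rep_indices:
  assumes "finite R"
  shows "(\<Sum>p\<in>rep_indices G R. F p) =
    (\<Sum>\<pi>\<in>R. \<Sum>i<rep_dim G \<pi>. \<Sum>j<rep_dim G \<pi>. F (\<pi>, i, j))"
proof -
  have "rep_indices G R = (SIGMA \<pi>:R. {..<rep_dim G \<pi>} \<times> {..<rep_dim G \<pi>})"
    by (auto simp: rep_indices_def)
  then show ?thesis
    using assms by (simp add: sum.Sigma sum.cartesian_product)
qed

text \<open>Irreducible representations have positive degree, so every member of \<open>R\<close>
  owns the index (\<pi>, 0, 0) and is seen by the first projection.\<close>

lemma finite_dual_representatives:
  assumes "dual_representatives G R" "finite (rep_indices G R)"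
  shows "finite R"
proof -
  have "(\<pi>, 0, 0) \<in> rep_indices G R" if "\<pi> \<in> R" for \<pi>
    using assms(1) that
    by (auto simp: rep_indices_def dual_representatives_def irreducible_unitary_rep_def)
  then have "R \<subseteq> fst ` rep_indices G R" by force
  then show ?thesis using assms(2) finite_subset by blast
qed

lemma equivalent_reps_refl:
  "equivalent_reps G \<pi> \<pi>" if "unitary_rep G \<pi>"
proof -
  have "1\<^sub>m (rep_dim G \<pi>) * \<pi> x = \<pi> x * 1\<^sub>m (rep_dim G \<pi>)" if "x \<in> carrier G" for x
    using unitary_rep_carrier[OF \<open>unitary_rep G \<pi>\<close> that] by simp
  moreover have "invertible_mat (1\<^sub>m (rep_dim G \<pi>) :: complex mat)"
    unfolding invertible_mat_def inverts_mat_def by (auto intro!: exI[of _ "1\<^sub>m (rep_dim G \<pi>)"])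
  ultimately show ?thesis unfolding equivalent_reps_def by auto
qed

lemma fourier_basis_entry:
  assumes "unitary_rep G \<pi>" "x \<in> carrier G" "i < rep_dim G \<pi>" "j < rep_dim G \<pi>"
  shows "fourier_basis G (\<pi>, i, j) x =
    complex_of_real (sqrt (real (rep_dim G \<pi>) / real (card (carrier G)))) * \<pi> x $$ (i, j)"
  using unitary_rep_carrier[OF assms(1,2)] assms(3,4)
  by (simp add: fourier_basis_def coord_fun_eq_entry)

text \<open>The factor sqrt(d_\<pi> / N) is chosen to cancel the value N / d_\<pi> in Schur
  orthogonality.\<close>

lemma fourier_basis_orthonormal:
  assumes fin: "finite (carrier G)" and R: "dual_representatives G R"
    and p: "p \<in> rep_indices G R" and q: "q \<in> rep_indices G R"
  shows "(\<Sum>x\<in>carrier G. fourier_basis G p x * cnj (fourier_basis G q x)) = (if p = q then 1 else 0)"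
proof -
  obtain \<sigma> a i \<pi> b j where pq: "p = (\<sigma>, a, i)" "q = (\<pi>, b, j)"
    by (metis prod_cases3)
  have i: "a < rep_dim G \<sigma>" "i < rep_dim G \<sigma>" "b < rep_dim G \<pi>" "j < rep_dim G \<pi>"
    and in_R: "\<sigma> \<in> R" "\<pi> \<in> R"
    using p q by (auto simp: pq rep_indices_def)
  have irr: "irreducible_unitary_rep G \<sigma>" "irreducible_unitary_rep G \<pi>"
    using R in_R by (auto simp: dual_representatives_def)
  then have u: "unitary_rep G \<sigma>" "unitary_rep G \<pi>"
    by (simp_all add: irreducible_unitary_rep_def)
  let ?s = "\<lambda>\<pi>. sqrt (real (rep_dim G \<pi>) / real (card (carrier G)))"
  have split: "(\<Sum>x\<in>carrier G. fourier_basis G p x * cnj (fourier_basis G q x)) =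
      complex_of_real (?s \<sigma> * ?s \<pi>) * (\<Sum>x\<in>carrier G. \<sigma> x $$ (a, i) * cnj (\<pi> x $$ (b, j)))"
    unfolding sum_distrib_left pq
    by (rule sum.cong[OF refl]) (simp add: fourier_basis_entry u i mult_ac)
  show ?thesis
  proof (cases "\<sigma> = \<pi>")
    case True
    have "complex_of_real (?s \<pi> * ?s \<pi>) = of_nat (rep_dim G \<pi>) / of_nat (card (carrier G))"
      by simp
    then show ?thesis
      using split schur_orthogonality_self[OF irr(2), of a i b j] i True fin
      by (auto simp: pq order_def)
  next
    case False
    \<comment> \<open>\<open>\<pi>\<close> represents its own class, so uniqueness of the
      representative excludes the different member \<open>\<sigma>\<close>.\<close>
    have "\<not> equivalent_reps G \<pi> \<sigma>"
      using R in_R irr equivalent_reps_refl[OF u(2)] False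
      unfolding dual_representatives_def by blast
    then show ?thesis
      using split schur_orthogonality_inequivalent[OF irr(2,1) _ i] False by (simp add: pq)
  qed
qed

text \<open>The weight depends only on the block, so it factors out of the sum over i and j. What
  remains in each block is d_\<pi> / N times a squared Frobenius norm, in which x no longer
  appears.\<close>

lemma sum_norm_fourier_basis:
  assumes fin: "finite (carrier G)" and R: "dual_representatives G R" "finite R"
    and x: "x \<in> carrier G"
  shows "(\<Sum>p\<in>rep_indices G R. (cmod (c (fst p)))\<^sup>2 * (cmod (fourier_basis G p x))\<^sup>2) =
    1 / real (card (carrier G)) * (\<Sum>\<pi>\<in>R. (cmod (c \<pi>))\<^sup>2 * (real (rep_dim G \<pi>))\<^sup>2)"
proof -
  have "(\<Sum>i<rep_dim G \<pi>. \<Sum>j<rep_dim G \<pi>. (cmod (c \<pi>))\<^sup>2 * (cmod (fourier_basis G (\<pi>, i, j) x))\<^sup>2) =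
      1 / real (card (carrier G)) * ((cmod (c \<pi>))\<^sup>2 * (real (rep_dim G \<pi>))\<^sup>2)" if "\<pi> \<in> R" for \<pi>
  proof -
    have u: "unitary_rep G \<pi>"
      using R that by (auto simp: dual_representatives_def irreducible_unitary_rep_def)
    have "(\<Sum>i<rep_dim G \<pi>. \<Sum>j<rep_dim G \<pi>. (cmod (c \<pi>))\<^sup>2 * (cmod (fourier_basis G (\<pi>, i, j) x))\<^sup>2) =
      (\<Sum>i<rep_dim G \<pi>. \<Sum>j<rep_dim G \<pi>. (cmod (c \<pi>))\<^sup>2 *
        (real (rep_dim G \<pi>) / real (card (carrier G))) * (cmod (\<pi> x $$ (i, j)))\<^sup>2)"
      by (intro sum.cong refl)
        (simp add: fourier_basis_entry[OF u x] norm_mult power_mult_distrib)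
    also have "\<dots> = (cmod (c \<pi>))\<^sup>2 * (real (rep_dim G \<pi>) / real (card (carrier G))) * real (rep_dim G \<pi>)"
      unfolding sum_distrib_left[symmetric] unitary_rep_entries_norm[OF u x] ..
    finally show ?thesis by (simp add: power2_eq_square)
  qed
  then show ?thesis
    by (simp add: sum_rep_indices[OF R(2)] sum_distrib_left)
qed

end

section \<open>Frames from two orthonormal bases\<close>

text \<open>Stated for plain index functions so that one Parseval identity serves both bases: the
  vectors \<open>f m\<close> and the Fourier basis sampled along the vertex enumeration.\<close>

definition orthonormal_rows :: "nat \<Rightarrow> (nat \<Rightarrow> nat \<Rightarrow> complex) \<Rightarrow> bool" where
  "orthonormal_rows n U \<longleftrightarrow>
    (\<forall>i<n. \<forall>j<n. (\<Sum>k<n. U i k * cnj (U j k)) = (if i = j then 1 else 0))"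

text \<open>Orthonormal rows say that the matrix times its adjoint is 1. As the matrix is square,
  the product in the other order is 1 too, which is the completeness relation.\<close>

lemma orthonormal_rows_columns:
  assumes "orthonormal_rows n U" "k < n" "l < n"
  shows "(\<Sum>i<n. cnj (U i k) * U i l) = (if k = l then 1 else 0)"
proof -
  let ?A = "mat n n (\<lambda>(i, k). U i k)" and ?B = "mat n n (\<lambda>(k, j). cnj (U j k))"
  have AB: "?A * ?B = 1\<^sub>m n"
    using assms(1)
    by (intro eq_matI) (auto simp: orthonormal_rows_def scalar_prod_def atLeast0LessThan)
  have "?B * ?A = 1\<^sub>m n"
    by (rule mat_mult_left_right_inverse[OF mat_carrier mat_carrier AB])
  then have "(?B * ?A) $$ (k, l) = 1\<^sub>m n $$ (k, l)" by (rule arg_cong)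
  then show ?thesis using assms(2,3) by (simp add: scalar_prod_def atLeast0LessThan)
qed

lemma parseval:
  assumes "orthonormal_rows n U"
  shows "(\<Sum>i<n. (cmod (\<Sum>k<n. h k * cnj (U i k)))\<^sup>2) = (\<Sum>k<n. (cmod (h k))\<^sup>2)"
proof -
  have "complex_of_real (\<Sum>i<n. (cmod (\<Sum>k<n. h k * cnj (U i k)))\<^sup>2)
      = (\<Sum>i<n. \<Sum>k<n. \<Sum>l<n. h k * cnj (h l) * (cnj (U i k) * U i l))"
    by (simp add: complex_norm_square sum_product mult_ac del: of_real_power)
  also have "\<dots> = (\<Sum>k<n. \<Sum>l<n. h k * cnj (h l) * (\<Sum>i<n. cnj (U i k) * U i l))"
    unfolding sum_distrib_left by (subst sum.swap, subst (2) sum.swap) simp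
  also have "\<dots> = (\<Sum>k<n. \<Sum>l<n. if k = l then h k * cnj (h l) else 0)"
    by (intro sum.cong refl) (simp add: orthonormal_rows_columns[OF assms])
  also have "\<dots> = complex_of_real (\<Sum>k<n. (cmod (h k))\<^sup>2)"
    by (simp add: complex_norm_square del: of_real_power)
  finally show ?thesis using of_real_eq_iff by blast
qed

text \<open>
  Parseval in the index \<open>m\<close> separates the frequencies \<open>k\<close>; Parseval in \<open>l\<close> then turns the
  windowed coefficients of \<open>h\<close> at frequency \<open>k\<close> back into the pointwise values of \<open>h\<close>.
\<close>

lemma sum_norm_modulated_windows:
  assumes f: "orthonormal_rows n f" and u: "orthonormal_rows n u"
  shows "(\<Sum>m<n. \<Sum>l<n. (cmod (\<Sum>x<n. h x * cnj (u l x * (\<Sum>k<n. f m k * a k * u k x))))\<^sup>2)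
    = (\<Sum>x<n. (cmod (h x))\<^sup>2 * (\<Sum>k<n. (cmod (a k))\<^sup>2 * (cmod (u k x))\<^sup>2))"
proof -
  \<comment> \<open>For fixed \<open>k\<close> these are the coefficients of the pointwise product
    of h and the conjugate of \<open>u k\<close> with respect to the rows of \<open>u\<close>; for
    fixed \<open>l\<close>, multiplied by \<open>cnj (a k)\<close>, they form the vector in k to
    which Parseval for \<open>f\<close> applies.\<close>
  define w where "w l k = (\<Sum>x<n. h x * cnj (u k x) * cnj (u l x))" for l k
  have inner: "(\<Sum>x<n. h x * cnj (u l x * (\<Sum>k<n. f m k * a k * u k x)))
      = (\<Sum>k<n. cnj (a k) * w l k * cnj (f m k))" for l m
  proof -
    have "(\<Sum>x<n. h x * cnj (u l x * (\<Sum>k<n. f m k * a k * u k x)))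
        = (\<Sum>x<n. \<Sum>k<n. cnj (a k) * (h x * cnj (u k x) * cnj (u l x)) * cnj (f m k))"
      by (simp add: sum_distrib_left mult_ac)
    also have "\<dots> = (\<Sum>k<n. cnj (a k) * w l k * cnj (f m k))"
      by (subst sum.swap) (simp add: w_def sum_distrib_left sum_distrib_right)
    finally show ?thesis .
  qed
  have "(\<Sum>m<n. \<Sum>l<n. (cmod (\<Sum>x<n. h x * cnj (u l x * (\<Sum>k<n. f m k * a k * u k x))))\<^sup>2)
      = (\<Sum>l<n. \<Sum>m<n. (cmod (\<Sum>k<n. cnj (a k) * w l k * cnj (f m k)))\<^sup>2)"
    unfolding inner by (rule sum.swap)
  also have "\<dots> = (\<Sum>l<n. \<Sum>k<n. (cmod (a k))\<^sup>2 * (cmod (w l k))\<^sup>2)"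
    by (simp add: parseval[OF f] norm_mult power_mult_distrib)
  also have "\<dots> = (\<Sum>k<n. (cmod (a k))\<^sup>2 * (\<Sum>l<n. (cmod (w l k))\<^sup>2))"
    by (subst sum.swap) (simp add: sum_distrib_left)
  also have "\<dots> = (\<Sum>k<n. \<Sum>x<n. (cmod (a k))\<^sup>2 * ((cmod (h x))\<^sup>2 * (cmod (u k x))\<^sup>2))"
    unfolding w_def by (simp add: parseval[OF u] norm_mult power_mult_distrib sum_distrib_left)
  also have "\<dots> = (\<Sum>x<n. (cmod (h x))\<^sup>2 * (\<Sum>k<n. (cmod (a k))\<^sup>2 * (cmod (u k x))\<^sup>2))"
    by (subst sum.swap) (simp add: sum_distrib_left mult_ac)
  finally show ?thesis .
qed

text \<open>An exact identity makes K both bounds at once. Testing any competing pair on one vector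
  of norm 1, which exists since n is positive, places K between the two.\<close>

lemma tight_frame_of_frame_identity:
  assumes n: "0 < n" and K: "0 < K" and I: "finite I"
    and car: "\<And>i. i \<in> I \<Longrightarrow> \<psi> i \<in> carrier_vec n"
    and eq: "\<And>h. h \<in> carrier_vec n \<Longrightarrow> (\<Sum>i\<in>I. (cmod (h \<bullet>c \<psi> i))\<^sup>2) = K * (l2_norm h)\<^sup>2"
  shows "tight_frame n I \<psi> \<and> optimal_frame_bounds n I \<psi> K K"
proof -
  have fb: "frame_bounds n I \<psi> K K" using K eq by (simp add: frame_bounds_def)
  let ?h = "unit_vec n 0 :: complex vec"
  have h: "?h \<in> carrier_vec n" by simp
  have "(\<Sum>k<n. (cmod (?h $ k))\<^sup>2) = (\<Sum>k<n. if k = 0 then 1 else 0)"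
    by (intro sum.cong) auto
  then have l2: "l2_norm ?h = 1" using n by (simp add: l2_norm_def)
  have "A \<le> K \<and> K \<le> B" if "frame_bounds n I \<psi> A B" for A B
    using that h eq[OF h] l2 unfolding frame_bounds_def by fastforce
  then have "optimal_frame_bounds n I \<psi> K K" using fb by (simp add: optimal_frame_bounds_def)
  then show ?thesis using I car fb unfolding tight_frame_def is_frame_def by blast
qed

section \<open>The frame of modulated and localised signals on the Cayley graph\<close>

theorem theorem7:
  fixes G :: "('a, 'm) monoid_scheme" (structure)
    and S :: "'a set"
    and \<Gamma> :: "'a pair_pre_digraph"
    and N :: nat
    and v :: "nat \<Rightarrow> 'a"
    and Ghat :: "('a \<Rightarrow> complex mat) set"
    and e :: "nat \<Rightarrow> ('a \<Rightarrow> complex mat) \<times> nat \<times> nat"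
    and \<phi> :: "nat \<Rightarrow> complex vec"
    and \<Phi> :: "complex mat"
    and g :: "'a \<Rightarrow> complex"
    and c :: "('a \<Rightarrow> complex mat) \<Rightarrow> complex"
    and f :: "nat \<Rightarrow> complex vec"
    and A :: "nat \<Rightarrow> complex mat"
    and \<psi> :: "nat \<times> nat \<Rightarrow> complex vec"
  assumes "group G" and "finite (carrier G)" and "card (carrier G) = N"
    and "S \<subseteq> carrier G"
    and "\<And>x s. x \<in> carrier G \<Longrightarrow> s \<in> S \<Longrightarrow> x \<otimes> s \<otimes> inv x \<in> S"
    and "\<Gamma> = cayley_graph G S"
    and "bij_betw v {..<N} (pverts \<Gamma>)"
    and "dual_representatives G Ghat"
    and "bij_betw e {..<N} (rep_indices G Ghat)"
    and "\<phi> = (\<lambda>k. signal_vec N v (fourier_basis G (e k)))"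
    and "\<Phi> = mat_of_cols N (map \<phi> [0..<N])"
    and "\<exists>x\<in>carrier G. g x \<noteq> 0"
    and "\<And>\<pi> i j. \<pi> \<in> Ghat \<Longrightarrow> i < rep_dim G \<pi> \<Longrightarrow> j < rep_dim G \<pi> \<Longrightarrow>
           fourier_coeff G g (fourier_basis G (\<pi>, i, j)) = c \<pi>"
    and "orthonormal_basis N f"
    and "A = (\<lambda>m. \<Phi> * mat_diag N (\<lambda>k. f m $ k) * mat_adjoint \<Phi>)"
    and "\<psi> = (\<lambda>(m, l). hadamard_vec (\<phi> l) (A m *\<^sub>v signal_vec N v g))"
  shows "tight_frame N ({..<N} \<times> {..<N}) \<psi> \<and>
    optimal_frame_bounds N ({..<N} \<times> {..<N}) \<psi>
      (1 / real N * (\<Sum>\<pi>\<in>Ghat. (cmod (c \<pi>))\<^sup>2 * (real (rep_dim G \<pi>))\<^sup>2))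
      (1 / real N * (\<Sum>\<pi>\<in>Ghat. (cmod (c \<pi>))\<^sup>2 * (real (rep_dim G \<pi>))\<^sup>2))"
proof -
  interpret group G by fact
  define u where "u l x = fourier_basis G (e l) (v x)" for l x
  define a where "a k = c (fst (e k))" for k
  define K where "K = 1 / real N * (\<Sum>\<pi>\<in>Ghat. (cmod (c \<pi>))\<^sup>2 * (real (rep_dim G \<pi>))\<^sup>2)"
  note fin = assms(2) and card_G = assms(3) and R = assms(8) and e = assms(9)
  note \<phi>_def = assms(10) and \<Phi>_def = assms(11) and A_def = assms(15) and \<psi>_def = assms(16)
  have v: "bij_betw v {..<N} (carrier G)"
    using assms(6,7) by (simp add: cayley_graph_def)
  have v_in: "v k \<in> carrier G" if "k < N" for k
    using bij_betwE[OF v] that by simp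
  have e_in: "e k \<in> rep_indices G Ghat" if "k < N" for k
    using bij_betwE[OF e] that by simp
  have N: "0 < N" using card_G fin one_closed card_gt_0_iff by blast
  have finR: "finite Ghat"
    using finite_dual_representatives[OF R] bij_betw_finite[OF e] by simp

  have u: "orthonormal_rows N u"
    unfolding orthonormal_rows_def
  proof (intro allI impI)
    fix i j assume ij: "i < N" "j < N"
    have "(\<Sum>k<N. u i k * cnj (u j k))
        = (\<Sum>x\<in>carrier G. fourier_basis G (e i) x * cnj (fourier_basis G (e j) x))"
      unfolding u_def by (rule sum.reindex_bij_betw[OF v])
    also have "\<dots> = (if i = j then 1 else 0)"
      using fourier_basis_orthonormal[OF fin R e_in[OF ij(1)] e_in[OF ij(2)]]
        bij_betw_imp_inj_on[OF e] ij by (auto simp: inj_on_eq_iff)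
    finally show "(\<Sum>k<N. u i k * cnj (u j k)) = (if i = j then 1 else 0)" .
  qed
  have f_car: "f m \<in> carrier_vec N" if "m < N" for m
    using assms(14) that by (simp add: orthonormal_basis_def)
  have f: "orthonormal_rows N (\<lambda>m k. f m $ k)"
    unfolding orthonormal_rows_def
  proof (intro allI impI)
    fix i j assume ij: "i < N" "j < N"
    have "f i \<bullet>c f j = (\<Sum>k<N. f i $ k * cnj (f j $ k))"
      using f_car[OF ij(1)] f_car[OF ij(2)] by (simp add: scalar_prod_def atLeast0LessThan)
    then show "(\<Sum>k<N. f i $ k * cnj (f j $ k)) = (if i = j then 1 else 0)"
      using assms(14) ij by (simp add: orthonormal_basis_def)
  qed

  have coeff: "(\<Sum>x<N. g (v x) * cnj (u k x)) = a k" if k: "k < N" for k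
  proof -
    have "(\<Sum>x<N. g (v x) * cnj (u k x)) = fourier_coeff G g (fourier_basis G (e k))"
      unfolding u_def fourier_coeff_def by (rule sum.reindex_bij_betw[OF v])
    then show ?thesis
      using e_in[OF k] assms(13) by (cases "e k") (auto simp: a_def rep_indices_def)
  qed
  have \<Phi>: "\<Phi> \<in> carrier_mat N N" and \<Phi>_entry: "\<And>x k. x < N \<Longrightarrow> k < N \<Longrightarrow> \<Phi> $$ (x, k) = u k x"
    by (auto simp: \<Phi>_def \<phi>_def u_def signal_vec_def mat_of_cols_def)
  note \<Phi>' = mat_adjoint_carrier[OF \<Phi>]
  have \<psi>_entry: "\<psi> (m, l) $ x = u l x * (\<Sum>k<N. f m $ k * a k * u k x)"
    and \<psi>_car: "\<psi> (m, l) \<in> carrier_vec N" if x: "x < N" for m l x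
  proof -
    let ?g = "signal_vec N v g" and ?D = "mat_diag N (\<lambda>k. f m $ k)"
    have g: "?g \<in> carrier_vec N" and D: "?D \<in> carrier_mat N N" by (simp_all add: signal_vec_def)
    \<comment> \<open>The adjoint of \<open>\<Phi>\<close> computes the Fourier coefficients of g,
      so \<open>A m\<close> acts as the Fourier multiplier with symbol \<open>f m\<close>.\<close>
    have hat: "mat_adjoint \<Phi> *\<^sub>v ?g = vec N a"
      using \<Phi>' coeff
      by (intro eq_vecI) (auto simp: scalar_prod_def atLeast0LessThan mat_adjoint_index[OF \<Phi>]
          signal_vec_def \<Phi>_entry mult.commute)
    have "?D *\<^sub>v vec N a = vec N (\<lambda>k. f m $ k * a k)"
      by (intro eq_vecI) (auto simp: mat_diag_def scalar_prod_def atLeast0LessThan if_distrib[of "\<lambda>z. z * _"] cong: if_cong)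
    moreover have "A m *\<^sub>v ?g = \<Phi> *\<^sub>v (?D *\<^sub>v (mat_adjoint \<Phi> *\<^sub>v ?g))"
      unfolding A_def using \<Phi> \<Phi>' D g
      by (simp add: assoc_mult_mat_vec[of _ N N _ N])
    ultimately have "A m *\<^sub>v ?g = \<Phi> *\<^sub>v vec N (\<lambda>k. f m $ k * a k)" using hat by simp
    then have "(A m *\<^sub>v ?g) $ x = (\<Sum>k<N. f m $ k * a k * u k x)"
      using \<Phi> x by (simp add: scalar_prod_def atLeast0LessThan \<Phi>_entry mult_ac)
    then show "\<psi> (m, l) $ x = u l x * (\<Sum>k<N. f m $ k * a k * u k x)"
      using x by (simp add: \<psi>_def hadamard_vec_def \<phi>_def signal_vec_def u_def)
    show "\<psi> (m, l) \<in> carrier_vec N"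
      by (simp add: \<psi>_def hadamard_vec_def \<phi>_def signal_vec_def)
  qed

  \<comment> \<open>Reindexing by \<open>e\<close> regroups the frequencies into the full blocks of
    the irreducible representations.\<close>
  have column: "(\<Sum>k<N. (cmod (a k))\<^sup>2 * (cmod (u k x))\<^sup>2) = K" if x: "x < N" for x
  proof -
    have "(\<Sum>k<N. (cmod (a k))\<^sup>2 * (cmod (u k x))\<^sup>2)
        = (\<Sum>p\<in>rep_indices G Ghat. (cmod (c (fst p)))\<^sup>2 * (cmod (fourier_basis G p (v x)))\<^sup>2)"
      unfolding a_def u_def by (rule sum.reindex_bij_betw[OF e])
    then show ?thesis
      using sum_norm_fourier_basis[OF fin R finR v_in[OF x]] card_G by (simp add: K_def)
  qed
  have identity: "(\<Sum>i\<in>{..<N} \<times> {..<N}. (cmod (h \<bullet>c \<psi> i))\<^sup>2) = K * (l2_norm h)\<^sup>2"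
    if h: "h \<in> carrier_vec N" for h
  proof -
    have "h \<bullet>c \<psi> (m, l) = (\<Sum>x<N. h $ x * cnj (u l x * (\<Sum>k<N. f m $ k * a k * u k x)))" for m l
      \<comment> \<open>The carrier fact was proved under a bound on x; the index 0 discharges it,
        since a group is nonempty.\<close>
      using \<psi>_car[OF N, of m l]
      by (auto simp: scalar_prod_def atLeast0LessThan \<psi>_entry intro!: sum.cong)
    then have "(\<Sum>i\<in>{..<N} \<times> {..<N}. (cmod (h \<bullet>c \<psi> i))\<^sup>2) = (\<Sum>m<N. \<Sum>l<N.
        (cmod (\<Sum>x<N. h $ x * cnj (u l x * (\<Sum>k<N. f m $ k * a k * u k x))))\<^sup>2)"
      by (simp add: sum.cartesian_product')
    also have "\<dots> = (\<Sum>x<N. (cmod (h $ x))\<^sup>2 * K)"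
      unfolding sum_norm_modulated_windows[OF f u] by (simp add: column)
    also have "\<dots> = K * (l2_norm h)\<^sup>2"
      using h by (simp add: l2_norm_def sum_nonneg sum_distrib_left mult.commute)
    finally show ?thesis .
  qed

  \<comment> \<open>All summands of K are nonnegative, so otherwise each vanishes; positive degrees
    then force every c(\<pi>) to be 0, and Parseval makes g vanish on the whole group.\<close>
  have "0 < K"
  proof (rule ccontr)
    assume "\<not> 0 < K"
    then have "(\<Sum>\<pi>\<in>Ghat. (cmod (c \<pi>))\<^sup>2 * (real (rep_dim G \<pi>))\<^sup>2) \<le> 0"
      using N by (simp add: K_def zero_less_divide_iff not_less)
    then have "(\<Sum>\<pi>\<in>Ghat. (cmod (c \<pi>))\<^sup>2 * (real (rep_dim G \<pi>))\<^sup>2) = 0"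
      by (intro antisym sum_nonneg) auto
    then have "(cmod (c \<pi>))\<^sup>2 * (real (rep_dim G \<pi>))\<^sup>2 = 0" if "\<pi> \<in> Ghat" for \<pi>
      using finR that by (subst (asm) sum_nonneg_eq_0_iff) auto
    then have "c \<pi> = 0" if "\<pi> \<in> Ghat" for \<pi>
      using that R by (fastforce simp: dual_representatives_def irreducible_unitary_rep_def)
    then have "a k = 0" if "k < N" for k
      using e_in[OF that] by (auto simp: a_def rep_indices_def)
    then have "(\<Sum>x<N. (cmod (g (v x)))\<^sup>2) = 0"
      using parseval[OF u, of "\<lambda>x. g (v x)"] coeff by simp
    then have "g (v x) = 0" if "x < N" for x
      using that by (subst (asm) sum_nonneg_eq_0_iff) auto
    then have "g x = 0" if "x \<in> carrier G" for x
      using that by (auto simp flip: bij_betw_imp_surj_on[OF v])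
    then show False using assms(12) by blast
  qed
  then show ?thesis
    using tight_frame_of_frame_identity[OF N _ _ _ identity] \<psi>_car[OF N]
    unfolding K_def by auto
qed

end
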